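(* Suppose $f:\mathcal{X}\to\mathbb{R}$ is convex and $\ell$-smooth where $\ell$ is sub-quadratic, and let $x_0\in\mathcal{X}$. Then there always exists a constant $G$ satisfying $$G\ge\max\left\{8\sqrt{\ell(2G)\left((f(x_0)-f^* )+\|x_0-x^*\|^2\right)},\ \|\nabla f(x_0)\|\right\}.$$ For such a $G$, denote $L:=\ell(2G)$ and choose $0<\eta\le\min\left\{\frac{1}{16L^2},\frac{1}{2L}\right\}$. Then the iterates generated by Nesterov's Accelerated Gradient Method (described in the context) with stepsize $\eta$ and initial point $x_0$ satisfy, for every integer $T\ge0$, $$f(x_T)-f^*\le\frac{4(f(x_0)-f^* )+4\|x_0-x^*\|^2}{\eta T^2+4}.$$
   Context: $\mathcal{X}\subseteq\mathbb{R}^d$ is the domain of $f$; $\|\cdot\|$ is the Euclidean norm for vectors and the operator norm for matrices. Standing assumptions: (1) $\mathcal{X}$ is open, $f$ is differentiable on $\mathcal{X}$ and closed, i.e. for each $a\in\mathbb{R}$ the sub-level set $\{x\in\mathcal{X}: f(x)\le a\}$ is closed (in $\mathbb{R}^d$); (2) $f^*:=\inf_{x\in\mathcal{X}}f(x)>-\infty$; (3) there is a point $x^*\in\mathcal{X}$ with $f(x^* )=f^*$. Convexity: $f$ is convex if $\mathcal{X}$ is a convex set and $f(y)-f(x)\ge\langle\nabla f(x),y-x\rangle$ for all $x,y\in\mathcal{X}$. $\ell$-smoothness: for a non-decreasing continuous function $\ell:[0,+\infty)\to(0,+\infty)$, a differentiable $f:\mathcal{X}\to\mathbb{R}$ is $\ell$-smooth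 if $\|\nabla^2f(x)\|\le\ell(\|\nabla f(x)\|)$ almost everywhere (with respect to the Lebesgue measure) in $\mathcal{X}$. $\ell$ is sub-quadratic if $\lim_{u\to\infty}\ell(u)/u^2=0$. Nesterov's Accelerated Gradient Method: initialize $z_0=x_0$, $B_0=0$, $A_0=1/\eta$. For $t=0,1,2,\dots$: $B_{t+1}=B_t+\frac12\left(1+\sqrt{4B_t+1}\right)$; $A_{t+1}=B_{t+1}+1/\eta$; $y_t=x_t+(1-A_t/A_{t+1})(z_t-x_t)$; $x_{t+1}=y_t-\eta\nabla f(y_t)$; $z_{t+1}=z_t-\eta(A_{t+1}-A_t)\nabla f(y_t)$. The assertion about the iterates includes that $x_t,y_t$ remain in $\mathcal{X}$, so that the recursion is well defined.
   Formalization: The definition of ℓ-smoothness additionally requires ∇f to be locally Lipschitz on X; with only the almost-everywhere Hessian bound the claim fails (e.g. when f' is built from the Cantor function, so that f''=0 a.e.). *)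

theory Defs
  imports "HOL-Analysis.Analysis"
begin

text \<open>
  A function with open domain \<open>X\<close> is a total function of which only the values on \<open>X\<close> are used.
  Where \<open>f\<close> is not differentiable, the value of \<open>grad f\<close> is unspecified.
\<close>

definition grad :: "('a::euclidean_space \<Rightarrow> real) \<Rightarrow> 'a \<Rightarrow> 'a" where
  "grad f x = (THE D. GDERIV f x :> D)"

definition hessian :: "('a::euclidean_space \<Rightarrow> real) \<Rightarrow> 'a \<Rightarrow> 'a \<Rightarrow> 'a" where
  "hessian f x = frechet_derivative (grad f) (at x)"

definition convex_diff :: "'a::euclidean_space set \<Rightarrow> ('a \<Rightarrow> real) \<Rightarrow> bool" where
  "convex_diff X f \<longleftrightarrow>
     convex X \<and> (\<forall>x\<in>X. \<forall>y\<in>X. f y - f x \<ge> grad f x \<bullet> (y - x))"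

definition closed_sublevels :: "'a::euclidean_space set \<Rightarrow> ('a \<Rightarrow> real) \<Rightarrow> bool" where
  "closed_sublevels X f \<longleftrightarrow> (\<forall>a. closed {x \<in> X. f x \<le> a})"

text \<open>The admissible functions from \<open>[0, \<infinity>)\<close> to \<open>(0, \<infinity>)\<close>.\<close>

definition growth_fun :: "(real \<Rightarrow> real) \<Rightarrow> bool" where
  "growth_fun l \<longleftrightarrow>
     (\<forall>u\<ge>0. l u > 0) \<and> mono_on {0..} l \<and> continuous_on {0..} l"

definition subquadratic :: "(real \<Rightarrow> real) \<Rightarrow> bool" where
  "subquadratic l \<longleftrightarrow> ((\<lambda>u. l u / u\<^sup>2) \<longlongrightarrow> 0) at_top"

text \<open>
  A bound on the pointwise Hessian almost everywhere says nothing about the singular part of the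
  variation of the gradient: a convex function on the line whose derivative is the Cantor function
  has second derivative \<open>0\<close> almost everywhere. The usual meaning of such a bound is that the
  pointwise Hessian determines the gradient by integration (it is also the weak derivative of the
  gradient). As \<open>l (norm (grad f x))\<close> is locally bounded when \<open>grad f\<close> is continuous, this
  amounts to local Lipschitz continuity of the gradient, which is the third conjunct.
\<close>

definition ell_smooth :: "'a::euclidean_space set \<Rightarrow> ('a \<Rightarrow> real) \<Rightarrow> (real \<Rightarrow> real) \<Rightarrow> bool" where
  "ell_smooth X f l \<longleftrightarrow>
     (\<forall>x\<in>X. f differentiable (at x)) \<and>
     (AE x in lebesgue. x \<in> X \<longrightarrow>
        grad f differentiable (at x) \<and> onorm (hessian f x) \<le> l (norm (grad f x))) \<and>
     (\<forall>x\<in>X. \<exists>r>0. \<exists>C. C-lipschitz_on (ball x r \<inter> X) (grad f))"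

primrec nag_B :: "nat \<Rightarrow> real" where
  "nag_B 0 = 0"
| "nag_B (Suc t) = nag_B t + 1/2 * (1 + sqrt (4 * nag_B t + 1))"

definition nag_A :: "real \<Rightarrow> nat \<Rightarrow> real" where
  "nag_A \<eta> t = nag_B t + 1 / \<eta>"

text \<open>In \<open>nag_x g \<eta> x0\<close> etc., \<open>g\<close> is the gradient oracle and \<open>\<eta>\<close> the stepsize.\<close>

function (sequential)
      nag_x :: "('a::euclidean_space \<Rightarrow> 'a) \<Rightarrow> real \<Rightarrow> 'a \<Rightarrow> nat \<Rightarrow> 'a"
  and nag_y :: "('a::euclidean_space \<Rightarrow> 'a) \<Rightarrow> real \<Rightarrow> 'a \<Rightarrow> nat \<Rightarrow> 'a"
  and nag_z :: "('a::euclidean_space \<Rightarrow> 'a) \<Rightarrow> real \<Rightarrow> 'a \<Rightarrow> nat \<Rightarrow> 'a"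
where
  "nag_x g \<eta> x0 0 = x0"
| "nag_x g \<eta> x0 (Suc t) = nag_y g \<eta> x0 t - \<eta> *\<^sub>R g (nag_y g \<eta> x0 t)"
| "nag_y g \<eta> x0 t = nag_x g \<eta> x0 t
     + (1 - nag_A \<eta> t / nag_A \<eta> (Suc t)) *\<^sub>R (nag_z g \<eta> x0 t - nag_x g \<eta> x0 t)"
| "nag_z g \<eta> x0 0 = x0"
| "nag_z g \<eta> x0 (Suc t) = nag_z g \<eta> x0 t
     - (\<eta> * (nag_A \<eta> (Suc t) - nag_A \<eta> t)) *\<^sub>R g (nag_y g \<eta> x0 t)"
  by pat_completeness auto
termination
  by (relation "Wellfounded.measure (\<lambda>s. case s of
        Inl (_, _, _, t) \<Rightarrow> 2 * t
      | Inr (Inl (_, _, _, t)) \<Rightarrow> 2 * t + 1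
      | Inr (Inr (_, _, _, t)) \<Rightarrow> 2 * t)") auto

lemma grad_eqI: "grad f x = D" if "GDERIV f x :> D"
proof -
  have "E = D" if "GDERIV f x :> E" for E
  proof -
    have "(\<lambda>h. h \<bullet> E) = (\<lambda>h. h \<bullet> D)"
      using has_derivative_unique that \<open>GDERIV f x :> D\<close> unfolding gderiv_def by blast
    then show ?thesis
      by (meson vector_eq_ldot)
  qed
  with that show ?thesis
    unfolding grad_def by blast
qed

end

theory Submission
  imports Defs
begin

text \<open>
  Write \<open>D = (f x\<^sub>0 - f\<^sup>*) + \<parallel>x\<^sub>0 - x\<^sup>*\<parallel>\<^sup>2\<close>, \<open>L = l (2 G)\<close> and \<open>a\<^sub>t = B\<^sub>t\<^sub>+\<^sub>1 - B\<^sub>t\<close>. If \<open>f\<close> were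
  \<open>L\<close>-smooth, the potential \<open>A\<^sub>t (f x\<^sub>t - f\<^sup>*) + \<parallel>z\<^sub>t - x\<^sup>*\<parallel>\<^sup>2 / (2 \<eta>)\<close> would not increase
  (\<open>nag_potential_step\<close>). It starts below \<open>D / \<eta>\<close>, and \<open>\<eta> A\<^sub>t \<ge> \<eta> t\<^sup>2 / 4 + 1\<close>, which is the claimed rate.
  What remains is to show that the method only sees the region where the gradient norm is below
  \<open>2 G\<close>, so that \<open>L\<close> is a valid smoothness constant.

  A point \<open>x\<close> with gradient norm at most \<open>G\<close> has a ball of radius \<open>G / L\<close> inside \<open>X\<close> on which gradients
  stay below \<open>2 G\<close> and are \<open>L\<close>-Lipschitz (\<open>ball_below\<close>). The Lipschitz bound comes from the almost
  everywhere bound on the Hessian by averaging over translates of a segment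
  (\<open>norm_integral_shift_le\<close>); the ball lies in \<open>X\<close> because sublevel sets are closed
  (\<open>segment_continuation\<close>).

  So \<open>y\<^sub>t\<close> must be close to \<open>x\<^sub>t\<close>. The potential keeps all \<open>z\<^sub>t\<close> within \<open>sqrt (2 D)\<close> of \<open>x\<^sup>*\<close>. The point
  \<open>x\<^sub>t\<close> is a convex combination of \<open>z\<^sub>0, \<dots>, z\<^sub>t\<close> (\<open>nag_average_step\<close>), hence equally close to \<open>x\<^sup>*\<close>. As
  \<open>y\<^sub>t\<close> lies on the segment from \<open>x\<^sub>t\<close> to \<open>z\<^sub>t\<close>, at a fraction of at most \<open>sqrt \<eta> / 2\<close> of its length
  (\<open>nag_extrapolation_small\<close>), its distance from \<open>x\<^sub>t\<close> is at most
  \<open>sqrt (2 D \<eta>) \<le> sqrt (D / L) \<le> G / (8 L)\<close> by the choice of \<open>\<eta>\<close> and \<open>G\<close>. The new point \<open>x\<^sub>t\<^sub>+\<^sub>1\<close> then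
  still lies in the ball, with a gradient norm clearly below \<open>2 G\<close>, and the bound
  \<open>f x\<^sub>t\<^sub>+\<^sub>1 - f\<^sup>* \<le> D\<close> from the potential brings this down to \<open>G\<close> again, since one more gradient step
  cannot fall below the minimum (\<open>norm_grad_sq_le\<close>). This closes the induction (\<open>nag_invariant\<close>).
\<close>

section \<open>Lipschitz constants from almost everywhere derivative bounds\<close>

lemma directional_quotient_tendsto:
  fixes g :: "'a::real_normed_vector \<Rightarrow> 'b::real_normed_vector"
  assumes der: "(g has_derivative g') (at x)" and h: "\<And>n. h n > 0" and h0: "h \<longlonglongrightarrow> (0::real)"
  shows "(\<lambda>n. (g (x + h n *\<^sub>R v) - g x) /\<^sub>R h n) \<longlonglongrightarrow> g' v"
proof -
  have line: "((\<lambda>s. x + s *\<^sub>R v) has_derivative (\<lambda>s. s *\<^sub>R v)) (at 0)"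
    by (auto intro!: derivative_eq_intros)
  have "((\<lambda>s. g (x + s *\<^sub>R v)) has_derivative (\<lambda>s. g' (s *\<^sub>R v))) (at 0)"
    using has_derivative_compose[OF line, of g g'] der by simp
  then have "((\<lambda>s. norm (g (x + s *\<^sub>R v) - g x - s *\<^sub>R g' v) / norm s) \<longlongrightarrow> 0) (at 0)"
    using linear_scale[OF has_derivative_linear[OF der]] by (simp add: has_derivative_at)
  moreover have "\<forall>\<^sub>F s in at 0. norm (g (x + s *\<^sub>R v) - g x - s *\<^sub>R g' v) / norm s
      = norm ((g (x + s *\<^sub>R v) - g x) /\<^sub>R s - g' v)"
  proof (rule eventually_at_filter[THEN iffD2, OF always_eventually], intro allI impI)
    fix s :: real assume "s \<noteq> 0"
    then have "(g (x + s *\<^sub>R v) - g x) /\<^sub>R s - g' v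
        = inverse s *\<^sub>R (g (x + s *\<^sub>R v) - g x - s *\<^sub>R g' v)"
      by (simp add: scaleR_diff_right)
    then show "norm (g (x + s *\<^sub>R v) - g x - s *\<^sub>R g' v) / norm s
        = norm ((g (x + s *\<^sub>R v) - g x) /\<^sub>R s - g' v)"
      by (simp add: divide_inverse mult.commute)
  qed
  ultimately have "((\<lambda>s. norm ((g (x + s *\<^sub>R v) - g x) /\<^sub>R s - g' v)) \<longlongrightarrow> 0) (at 0)"
    by (rule Lim_transform_eventually)
  then have lim: "((\<lambda>s. (g (x + s *\<^sub>R v) - g x) /\<^sub>R s) \<longlongrightarrow> g' v) (at 0)"
    by (rule LIM_zero_cancel[OF tendsto_norm_zero_cancel])
  have "\<And>n. h n \<noteq> 0"
    using h by (metis less_irrefl)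
  then have "filterlim h (at 0) sequentially"
    using h0 by (simp add: filterlim_at)
  then show ?thesis
    by (rule filterlim_compose[OF lim])
qed

text \<open>
  The key to turning an almost everywhere bound into a bound on increments. Along a single segment
  the exceptional set \<open>N\<close> may have full length, so the segment is replaced by the translates
  \<open>p + t v + u\<close> with \<open>u\<close> ranging over a box. For each \<open>t\<close> the translate of \<open>N\<close> is negligible in \<open>u\<close>;
  by dominated convergence, with a dominating constant from the Lipschitz property, difference
  quotients of the averaged function \<open>F\<close> to the right of \<open>t\<close> converge to the average of the directional
  derivatives, which obeys the bound at every \<open>t\<close>.
\<close>

lemma norm_integral_shift_le:
  fixes g :: "'a::euclidean_space \<Rightarrow> 'b::euclidean_space"
  assumes g: "C-lipschitz_on S g"
    and "negligible N" 
    and ae: "\<And>x. x \<in> S - N \<Longrightarrow> \<exists>g'. (g has_derivative g') (at x) \<and> onorm g' \<le> M"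
    and "M \<ge> 0"
    and inS: "\<And>t u. t \<in> {0..1} \<Longrightarrow> u \<in> cbox a b \<Longrightarrow> p + t *\<^sub>R v + u \<in> S"
  shows "norm (integral (cbox a b) (\<lambda>u. g (p + v + u)) - integral (cbox a b) (\<lambda>u. g (p + u)))
    \<le> M * norm v * measure lborel (cbox a b)"
proof -
  define F where "F t = integral (cbox a b) (\<lambda>u. g (p + t *\<^sub>R v + u))" for t
  define V where "V = measure lborel (cbox a b)"
  have C: "C \<ge> 0" and V: "V \<ge> 0"
    using g by (auto simp: lipschitz_on_def V_def)
  have int: "(\<lambda>u. g (p + t *\<^sub>R v + u)) integrable_on cbox a b" if "t \<in> {0..1}" for t
  proof (rule integrable_continuous)
    have "continuous_on (cbox a b) (g \<circ> (\<lambda>u. p + t *\<^sub>R v + u))"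
      by (intro continuous_on_compose continuous_intros
          continuous_on_subset[OF lipschitz_on_continuous_on[OF g]]) (use that inS in auto)
    then show "continuous_on (cbox a b) (\<lambda>u. g (p + t *\<^sub>R v + u))"
      by (simp add: o_def)
  qed
  have diff: "F s - F t = integral (cbox a b) (\<lambda>u. g (p + s *\<^sub>R v + u) - g (p + t *\<^sub>R v + u))"
    if "s \<in> {0..1}" "t \<in> {0..1}" for s t
    unfolding F_def using int that by (simp add: integral_diff)
  have lip: "norm (g (p + s *\<^sub>R v + u) - g (p + t *\<^sub>R v + u)) \<le> C * norm v * \<bar>s - t\<bar>"
    if "s \<in> {0..1}" "t \<in> {0..1}" "u \<in> cbox a b" for s t u
  proof -
    have "p + s *\<^sub>R v + u - (p + t *\<^sub>R v + u) = (s - t) *\<^sub>R v"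
      by (simp add: algebra_simps)
    then show ?thesis
      using lipschitz_onD[OF g inS[OF that(1,3)] inS[OF that(2,3)]]
      by (simp add: dist_norm mult_ac)
  qed
  have cont: "continuous_on {0..1} F"
  proof (rule lipschitz_on_continuous_on[where L = "C * norm v * V"], rule lipschitz_onI)
    show "dist (F s) (F t) \<le> C * norm v * V * dist s t" if "s \<in> {0..1}" "t \<in> {0..1}" for s t
      using integrable_bound[of "C * norm v * \<bar>s - t\<bar>"
            "\<lambda>u. g (p + s *\<^sub>R v + u) - g (p + t *\<^sub>R v + u)" a b] lip[OF that] int that C
      by (simp add: dist_norm diff V_def integrable_diff mult_ac)
  qed (use C V in simp)
  have right: "\<exists>s\<in>{t<..1}. dist (F s) (F t) \<le> (M * norm v * V + e) * (s - t)"
    if t: "t \<in> {0..<1}" and e: "e > 0" for t e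
  proof -
    \<comment> \<open>Difference quotients to the right of \<open>t\<close>, along steps that stay inside the unit interval.\<close>
    define h where "h n = (1 - t) / real (Suc n)" for n
    have h: "h n > 0" "h n \<le> 1 - t" for n
      using t mult_right_mono[of t 1 "real n"] by (auto simp: h_def field_simps)
    have h0: "h \<longlonglongrightarrow> 0"
      unfolding h_def using LIMSEQ_Suc lim_const_over_n by fastforce
    have th: "t + h n \<in> {0..1}" "t \<in> {0..1}" for n
      using h[of n] t by auto
    define N' where "N' = {u. p + t *\<^sub>R v + u \<in> N}"
    have "N' = (+) (- (p + t *\<^sub>R v)) ` N"
      by (auto simp: N'_def image_iff algebra_simps)
    then have N': "negligible N'"
      using negligible_translation[OF \<open>negligible N\<close>] by simp
    \<comment> \<open>The value \<open>0\<close> on \<open>N'\<close> makes the derivative bound hold on the whole box.\<close>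
    define D where "D u = (if u \<in> N' then 0 else frechet_derivative g (at (p + t *\<^sub>R v + u)) v)" for u
    define q where "q n u = (g (p + (t + h n) *\<^sub>R v + u) - g (p + t *\<^sub>R v + u)) /\<^sub>R h n" for n u
    let ?S = "cbox a b - N'"
    have spike: "integral ?S k = integral (cbox a b) k" for k :: "'a \<Rightarrow> 'b"
      by (rule integral_subset_negligible) (auto intro: negligible_subset[OF N'])
    have q_int: "q n integrable_on cbox a b" for n
      unfolding q_def using int[OF th(1)] int[OF th(2)] by (intro integrable_cmul integrable_diff)
    have qS: "q n integrable_on ?S" for n
      by (rule integrable_spike_set[OF q_int]) (auto intro: negligible_subset[OF N'])
    have constS: "(\<lambda>u. C * norm v) integrable_on ?S"
      by (rule integrable_spike_set[of _ "cbox a b"]) (auto intro: negligible_subset[OF N'])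
    have le: "norm (q n u) \<le> C * norm v" if "u \<in> ?S" for n u
    proof -
      have "norm (q n u) = norm (g (p + (t + h n) *\<^sub>R v + u) - g (p + t *\<^sub>R v + u)) / h n"
        using h[of n] by (simp add: q_def divide_inverse mult.commute)
      then show ?thesis
        using lip[OF th, of u n] that h[of n] by (simp add: pos_divide_le_eq)
    qed
    have D_props: "(\<lambda>n. q n u) \<longlonglongrightarrow> D u \<and> norm (D u) \<le> M * norm v" if u: "u \<in> ?S" for u
    proof -
      have "p + t *\<^sub>R v + u \<in> S - N"
        using u inS[OF th(2)] by (auto simp: N'_def)
      then obtain g' where g': "(g has_derivative g') (at (p + t *\<^sub>R v + u))" "onorm g' \<le> M"
        using ae by blast
      have D: "D u = g' v"
        using frechet_derivative_at[OF g'(1)] u by (simp add: D_def)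
      have "norm (g' v) \<le> onorm g' * norm v"
        using has_derivative_bounded_linear[OF g'(1)] by (rule onorm)
      also have "\<dots> \<le> M * norm v"
        using g'(2) by (simp add: mult_right_mono)
      finally have "norm (D u) \<le> M * norm v"
        by (simp add: D)
      moreover have "(\<lambda>n. q n u) \<longlonglongrightarrow> D u"
        using directional_quotient_tendsto[OF g'(1) h(1) h0, of v]
        by (simp add: D q_def algebra_simps)
      ultimately show ?thesis by simp
    qed
    note dom = dominated_convergence[OF qS constS le D_props[THEN conjunct1]]
    have D_int: "D integrable_on cbox a b"
      by (rule integrable_spike_set[OF dom(1)]) (auto intro: negligible_subset[OF N'])
    have "norm (integral (cbox a b) D) \<le> M * norm v * V"
      unfolding V_def
    proof (rule integrable_bound[OF _ D_int])
      show "norm (D u) \<le> M * norm v" if "u \<in> cbox a b" for u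
        using that D_props[of u] \<open>M \<ge> 0\<close> by (cases "u \<in> N'") (auto simp: D_def)
    qed (use \<open>M \<ge> 0\<close> in simp)
    moreover have "(\<lambda>n. norm (integral (cbox a b) (q n))) \<longlonglongrightarrow> norm (integral (cbox a b) D)"
      using dom(2) by (simp add: spike tendsto_norm)
    ultimately have "\<forall>\<^sub>F n in sequentially. norm (integral (cbox a b) (q n)) < M * norm v * V + e"
      using e by (intro order_tendstoD(2)) auto
    then obtain n where n: "norm (integral (cbox a b) (q n)) < M * norm v * V + e"
      using eventually_happens by fastforce
    have "F (t + h n) - F t = h n *\<^sub>R integral (cbox a b) (q n)"
      using h[of n] unfolding q_def diff[OF th] by (simp add: integral_cmul)
    then have "dist (F (t + h n)) (F t) = h n * norm (integral (cbox a b) (q n))"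
      using h[of n] by (simp add: dist_norm)
    also have "\<dots> \<le> h n * (M * norm v * V + e)"
      using n h[of n] by (intro mult_left_mono) auto
    finally show ?thesis
      using h[of n] by (intro bexI[of _ "t + h n"]) (auto simp: mult.commute)
  qed
  have "dist (F 1) (F 0) \<le> M * norm v * V + e" if "e > 0" for e
    using locally_lipschitz_imp_lipschitz_aux[OF _ cont right[OF _ that]] by simp
  then have "dist (F 1) (F 0) \<le> M * norm v * V"
    by (rule field_le_epsilon)
  then show ?thesis
    by (simp add: F_def V_def dist_norm)
qed

text \<open>
  Averages of \<open>g\<close> over boxes shrinking to \<open>y\<close> and to \<open>p\<close> differ from \<open>g y\<close> and \<open>g p\<close> by an amount
  that vanishes with the size of the boxes, because \<open>g\<close> is Lipschitz with some constant \<open>C\<close>; the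
  averages themselves satisfy the sharp bound. So the crude constant \<open>C\<close> improves to \<open>M\<close>.
\<close>

lemma lipschitz_on_ball_if_AE_derivative_bound:
  fixes g :: "'a::euclidean_space \<Rightarrow> 'b::euclidean_space"
  assumes g: "C-lipschitz_on (ball c r) g"
    and ae: "AE x in lebesgue. x \<in> ball c r \<longrightarrow> (\<exists>g'. (g has_derivative g') (at x) \<and> onorm g' \<le> M)"
    and M: "M \<ge> 0"
  shows "M-lipschitz_on (ball c r) g"
proof (rule lipschitz_onI[OF _ M])
  fix y p assume yp: "y \<in> ball c r" "p \<in> ball c r"
  obtain N where N: "negligible N"
    and ae: "\<And>x. x \<in> ball c r - N \<Longrightarrow> \<exists>g'. (g has_derivative g') (at x) \<and> onorm g' \<le> M"
    using ae unfolding eventually_ae_filter_negligible by blast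
  define v where "v = y - p"
  have C: "C \<ge> 0"
    using g by (rule lipschitz_on_nonneg)
  have "norm (g y - g p) \<le> M * norm v + e" if e: "e > 0" for e
  proof -
    \<comment> \<open>Two replacement errors of \<open>C * d\<close> each must cost at most \<open>e\<close>, and the shifted boxes must
      stay inside the ball.\<close>
    define d where "d = min (e / (2 * (C + 1))) (min (r - dist c y) (r - dist c p))"
    have d: "d > 0" "2 * C * d \<le> e" "dist c y + d \<le> r" "dist c p + d \<le> r"
    proof -
      show "d > 0" using yp e C by (simp add: d_def)
      have "2 * C * d \<le> 2 * (C + 1) * (e / (2 * (C + 1)))"
        using C \<open>d > 0\<close> by (intro mult_mono) (auto simp: d_def)
      then show "2 * C * d \<le> e" using C by simp
    qed (auto simp: d_def)
    obtain a b :: 'a where ab: "cbox a b \<subseteq> ball 0 d" "\<forall>i\<in>Basis. a \<bullet> i < b \<bullet> i"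
      using open_contains_cbox[of "ball 0 d" "0::'a"] d(1) by (metis centre_in_ball open_ball)
    define V where "V = measure lborel (cbox a b)"
    have V: "V > 0"
      using ab(2) by (simp add: V_def content_pos_lt_eq)
    have inball: "p + t *\<^sub>R v + u \<in> ball c r" if "t \<in> {0..1}" "u \<in> cbox a b" for t u
    proof -
      have "p + u \<in> ball c r" "y + u \<in> ball c r"
        using that ab(1) d norm_triangle_ineq4[of "c - p" u] norm_triangle_ineq4[of "c - y" u]
        by (auto simp: dist_norm algebra_simps subset_iff)
      then have "(1 - t) *\<^sub>R (p + u) + t *\<^sub>R (y + u) \<in> ball c r"
        using that by (intro convexD[OF convex_ball]) auto
      then show ?thesis
        by (simp add: v_def algebra_simps)
    qed
    have cont: "(\<lambda>u. g (x + u)) integrable_on cbox a b"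
      if "\<And>u. u \<in> cbox a b \<Longrightarrow> x + u \<in> ball c r" for x
    proof (rule integrable_continuous)
      have "continuous_on (cbox a b) (g \<circ> (\<lambda>u. x + u))"
        by (intro continuous_on_compose continuous_intros
            continuous_on_subset[OF lipschitz_on_continuous_on[OF g]]) (use that in auto)
      then show "continuous_on (cbox a b) (\<lambda>u. g (x + u))"
        by (simp add: o_def)
    qed
    have in_p: "p + u \<in> ball c r" and in_y: "p + v + u \<in> ball c r" if "u \<in> cbox a b" for u
      using inball[of 0 u] inball[of 1 u] that by auto
    let ?I = "\<lambda>x. integral (cbox a b) (\<lambda>u. g (x + u))"
    have close: "norm (?I x - V *\<^sub>R g x) \<le> C * d * V"
      if "x \<in> ball c r" "\<And>u. u \<in> cbox a b \<Longrightarrow> x + u \<in> ball c r" for x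
    proof -
      have "?I x - V *\<^sub>R g x = integral (cbox a b) (\<lambda>u. g (x + u) - g x)"
        unfolding V_def
        using integral_unique[OF has_integral_diff[OF integrable_integral[OF cont[OF that(2)]]
              has_integral_const[of "g x" a b]]]
        by simp
      also have "norm \<dots> \<le> C * d * V"
        unfolding V_def
      proof (rule integrable_bound)
        fix u assume u: "u \<in> cbox a b"
        have "norm (g (x + u) - g x) \<le> C * norm u"
          using lipschitz_onD[OF g that(2)[OF u] that(1)] by (simp add: dist_norm)
        also have "\<dots> \<le> C * d"
          using u ab(1) C by (intro mult_left_mono) (auto simp: subset_iff intro: less_imp_le)
        finally show "norm (g (x + u) - g x) \<le> C * d" .
      next
        show "(\<lambda>u. g (x + u) - g x) integrable_on cbox a b"
          using has_integral_diff[OF integrable_integral[OF cont[OF that(2)]]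
              has_integral_const[of "g x" a b]] by blast
      qed (use C d in simp)
      finally show ?thesis .
    qed
    have shift: "norm (?I (p + v) - ?I p) \<le> M * norm v * V"
      unfolding V_def by (rule norm_integral_shift_le[OF g N ae M inball])
    have "p + v = y"
      by (simp add: v_def)
    then have close_y: "norm (?I (p + v) - V *\<^sub>R g (p + v)) \<le> C * d * V"
      by (intro close in_y) (simp_all only: yp)
    have close_p: "norm (?I p - V *\<^sub>R g p) \<le> C * d * V"
      by (intro close in_p yp)
    have eq: "V *\<^sub>R (g y - g p)
        = (?I (p + v) - ?I p) - (?I (p + v) - V *\<^sub>R g (p + v)) + (?I p - V *\<^sub>R g p)"
      using \<open>p + v = y\<close> by (simp add: scaleR_diff_right)
    have "V * norm (g y - g p) = norm (V *\<^sub>R (g y - g p))"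
      using V by simp
    also have "\<dots> = norm ((?I (p + v) - ?I p) - (?I (p + v) - V *\<^sub>R g (p + v)) + (?I p - V *\<^sub>R g p))"
      unfolding eq ..
    also have "\<dots> \<le> norm (?I (p + v) - ?I p) + norm (?I (p + v) - V *\<^sub>R g (p + v)) + norm (?I p - V *\<^sub>R g p)"
      using norm_triangle_ineq[of "?I (p + v) - ?I p - (?I (p + v) - V *\<^sub>R g (p + v))" "?I p - V *\<^sub>R g p"]
        norm_triangle_ineq4[of "?I (p + v) - ?I p" "?I (p + v) - V *\<^sub>R g (p + v)"]
      by linarith
    also have "\<dots> \<le> M * norm v * V + C * d * V + C * d * V"
      by (intro add_mono shift close_y close_p)
    also have "\<dots> = V * (M * norm v + 2 * C * d)"
      by (simp add: algebra_simps)
    finally have "norm (g y - g p) \<le> M * norm v + 2 * C * d"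
      using V by simp
    then show ?thesis
      using d by simp
  qed
  then have "norm (g y - g p) \<le> M * norm v"
    by (rule field_le_epsilon)
  then show "dist (g y) (g p) \<le> M * dist y p"
    by (simp add: dist_norm v_def)
qed

section \<open>Convex functions with gradient-dependent smoothness\<close>

locale ell_smooth_convex =
  fixes X :: "'a::euclidean_space set" and f :: "'a \<Rightarrow> real" and l :: "real \<Rightarrow> real"
  assumes open_X: "open X"
    and closed_sublevels: "closed_sublevels X f"
    and convex_f: "convex_diff X f"
    and growth: "growth_fun l"
    and smooth: "ell_smooth X f l"
begin

lemma l_pos: "u \<ge> 0 \<Longrightarrow> l u > 0"
  using growth by (simp add: growth_fun_def)

lemma l_mono: "0 \<le> u \<Longrightarrow> u \<le> v \<Longrightarrow> l u \<le> l v"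
  using growth by (auto simp: growth_fun_def mono_on_def)

lemma first_order: "x \<in> X \<Longrightarrow> y \<in> X \<Longrightarrow> f y \<ge> f x + grad f x \<bullet> (y - x)"
  using convex_f by (force simp: convex_diff_def)

lemma grad_locally_lipschitz:
  assumes "x \<in> X"
  obtains r C where "r > 0" "ball x r \<subseteq> X" "C-lipschitz_on (ball x r) (grad f)"
proof -
  obtain r C where r: "r > 0" "C-lipschitz_on (ball x r \<inter> X) (grad f)"
    using smooth assms unfolding ell_smooth_def by blast
  obtain r' where r': "r' > 0" "ball x r' \<subseteq> X"
    using open_X assms by (auto simp: open_contains_ball)
  show ?thesis
  proof
    show "min r r' > 0" "ball x (min r r') \<subseteq> X"
      using r r' by auto
    show "C-lipschitz_on (ball x (min r r')) (grad f)"
      using r' by (intro lipschitz_on_subset[OF r(2)]) auto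
  qed
qed

lemma continuous_on_grad: "continuous_on X (grad f)"
proof (rule continuous_at_imp_continuous_on, rule)
  fix x assume "x \<in> X"
  then obtain r C where "r > 0" "C-lipschitz_on (ball x r) (grad f)"
    using grad_locally_lipschitz by metis
  then show "isCont (grad f) x"
    using lipschitz_on_continuous_on[of C "ball x r" "grad f"] by (simp add: continuous_on_eq_continuous_at)
qed

text \<open>
  Continuity keeps the gradient norm below \<open>R\<close> near \<open>x\<close>, where monotonicity of \<open>l\<close> then bounds the
  Hessian by the constant \<open>l R\<close> almost everywhere. The local Lipschitz constant of the gradient,
  which is arbitrary, improves to \<open>l R\<close>.
\<close>

lemma locally_lipschitz_below:
  assumes x: "x \<in> X" and R: "norm (grad f x) < R"
  obtains r where "r > 0" "ball x r \<subseteq> X" "\<And>y. y \<in> ball x r \<Longrightarrow> norm (grad f y) < R"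
    "(l R)-lipschitz_on (ball x r) (grad f)"
proof -
  obtain r C where r: "r > 0" "ball x r \<subseteq> X" "C-lipschitz_on (ball x r) (grad f)"
    using grad_locally_lipschitz[OF x] .
  have "isCont (grad f) x"
    using continuous_on_grad continuous_on_eq_continuous_at[OF open_X] x by blast
  then have "\<forall>\<^sub>F y in nhds x. norm (grad f y) < R"
    using R by (intro order_tendstoD(2)) (auto simp: continuous_at_imp_continuous_within isCont_def
        tendsto_at_iff_tendsto_nhds intro!: tendsto_norm)
  then obtain e where e: "e > 0" "\<And>y. dist y x < e \<Longrightarrow> norm (grad f y) < R"
    by (auto simp: eventually_nhds_metric)
  define s where "s = min r e"
  have s: "s > 0" "ball x s \<subseteq> ball x r" "\<And>y. y \<in> ball x s \<Longrightarrow> norm (grad f y) < R"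
    using r(1) e by (auto simp: s_def dist_commute)
  have "AE y in lebesgue. y \<in> X \<longrightarrow>
      grad f differentiable (at y) \<and> onorm (hessian f y) \<le> l (norm (grad f y))"
    using smooth by (simp add: ell_smooth_def)
  then have "AE y in lebesgue. y \<in> ball x s \<longrightarrow>
      (\<exists>g'. (grad f has_derivative g') (at y) \<and> onorm g' \<le> l R)"
  proof eventually_elim
    case (elim y)
    show ?case
    proof
      assume y: "y \<in> ball x s"
      then have "y \<in> X" "norm (grad f y) \<le> R"
        using s r(2) less_imp_le by blast+
      then have "(grad f has_derivative hessian f y) (at y)" "onorm (hessian f y) \<le> l R"
        using elim l_mono[of "norm (grad f y)" R]
        by (auto simp: hessian_def frechet_derivative_works)
      then show "\<exists>g'. (grad f has_derivative g') (at y) \<and> onorm g' \<le> l R"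
        by blast
    qed
  qed
  moreover have "l R \<ge> 0"
    using l_pos[of R] R norm_ge_zero[of "grad f x"] by linarith
  ultimately have "(l R)-lipschitz_on (ball x s) (grad f)"
    using lipschitz_on_ball_if_AE_derivative_bound[OF lipschitz_on_subset[OF r(3) s(2)]] by blast
  then show ?thesis
    using that s r(2) by blast
qed

lemma grad_lipschitz_along_segment:
  assumes \<tau>: "0 \<le> \<tau>" and inX: "\<And>s. s \<in> {0..\<tau>} \<Longrightarrow> x + s *\<^sub>R v \<in> X"
    and R: "\<And>s. s \<in> {0..<\<tau>} \<Longrightarrow> norm (grad f (x + s *\<^sub>R v)) < R"
  shows "dist (grad f (x + \<tau> *\<^sub>R v)) (grad f x) \<le> l R * norm v * \<tau>"
proof -
  let ?g = "\<lambda>s. grad f (x + s *\<^sub>R v)"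
  have "dist (?g \<tau>) (?g 0) \<le> (l R * norm v) * (\<tau> - 0)"
  proof (rule locally_lipschitz_imp_lipschitz_aux[OF \<tau>])
    have "continuous_on {0..\<tau>} (grad f \<circ> (\<lambda>s. x + s *\<^sub>R v))"
      by (intro continuous_on_compose continuous_intros continuous_on_subset[OF continuous_on_grad])
        (use inX in auto)
    then show "continuous_on {0..\<tau>} ?g"
      by (simp add: o_def)
  next
    fix s assume s: "s \<in> {0..<\<tau>}"
    then obtain r where r: "r > 0" "(l R)-lipschitz_on (ball (x + s *\<^sub>R v) r) (grad f)"
      using locally_lipschitz_below[OF inX R] by (metis atLeastLessThan_iff atLeastAtMost_iff less_imp_le)
    define w where "w = norm v + 1"
    have w: "w > 0" "norm v \<le> w"
      by (simp_all add: w_def add_nonneg_pos)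
    define y where "y = min \<tau> (s + r / 2 / w)"
    have y: "y \<in> {s<..\<tau>}"
      using s r(1) w by (auto simp: y_def)
    have "(y - s) * norm v \<le> (r / 2 / w) * w"
      using y r(1) w by (intro mult_mono) (auto simp: y_def)
    also have "\<dots> < r"
      using w r(1) by simp
    finally have yr: "(y - s) * norm v < r" .
    have eq: "x + y *\<^sub>R v - (x + s *\<^sub>R v) = (y - s) *\<^sub>R v"
      by (simp add: algebra_simps)
    have d: "dist (x + y *\<^sub>R v) (x + s *\<^sub>R v) = (y - s) * norm v"
      unfolding dist_norm eq using y by simp
    have "dist (?g y) (?g s) \<le> l R * dist (x + y *\<^sub>R v) (x + s *\<^sub>R v)"
      by (rule lipschitz_onD[OF r(2)]) (use d yr r(1) in \<open>auto simp: dist_commute\<close>)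
    then show "\<exists>y\<in>{s<..\<tau>}. dist (?g y) (?g s) \<le> (l R * norm v) * (y - s)"
      using y d by (intro bexI[of _ y]) (auto simp: mult_ac)
  qed
  then show ?thesis by simp
qed

text \<open>
  A continuation argument. As long as the segment stays in \<open>X\<close> with gradients below \<open>R\<close>, the
  gradient grows by at most \<open>l R\<close> per unit length, which by assumption is too slow to reach \<open>R\<close>.
  The segment cannot leave \<open>X\<close> first: with bounded gradients \<open>f\<close> stays bounded along it, and a
  boundary point of \<open>X\<close> is not a limit of points of a sublevel set, sublevel sets being closed.
\<close>

lemma segment_continuation:
  assumes x: "x \<in> X" and R: "R \<ge> 0" and v: "norm (grad f x) + l R * norm v < R" and t: "t \<in> {0..1}"
  shows "x + t *\<^sub>R v \<in> X \<and> norm (grad f (x + t *\<^sub>R v)) < R"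
proof (rule ccontr)
  define P where "P s \<longleftrightarrow> x + s *\<^sub>R v \<in> X \<and> norm (grad f (x + s *\<^sub>R v)) < R" for s
  define bad where "bad = {s \<in> {0..1}. \<not> P s}"
  assume "\<not> ?thesis"
  then have t_bad: "t \<in> bad"
    using t by (simp add: bad_def P_def)
  define \<tau> where "\<tau> = Inf bad"
  have bdd: "bdd_below bad"
    by (rule bdd_belowI[of _ 0]) (auto simp: bad_def)
  have \<tau>: "0 \<le> \<tau>" "\<tau> \<le> 1"
  proof -
    show "0 \<le> \<tau>"
      unfolding \<tau>_def using t_bad by (intro cInf_greatest) (auto simp: bad_def)
    have "\<tau> \<le> t"
      unfolding \<tau>_def using t_bad bdd by (rule cInf_lower)
    then show "\<tau> \<le> 1"
      using t by simp
  qed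
  have before: "P s" if "s \<in> {0..<\<tau>}" for s
    using that cInf_lower[OF _ bdd, of s] \<tau> by (force simp: \<tau>_def bad_def)
  have lR: "l R \<ge> 0"
    using l_pos[OF R] by simp
  \<comment> \<open>The first bad parameter cannot be due to leaving \<open>X\<close>: the points before it lie in a closed sublevel set.\<close>
  have inX: "x + \<tau> *\<^sub>R v \<in> X"
  proof (cases "\<tau> = 0")
    case False
    define S where "S = {y \<in> X. f y \<le> f x + R * norm v}"
    have "closed S"
      using closed_sublevels by (simp add: closed_sublevels_def S_def)
    moreover have "x + s *\<^sub>R v \<in> S" if s: "s \<in> {0..<\<tau>}" for s
    proof -
      have P: "P s" and s1: "0 \<le> s" "s \<le> 1"
        using before[OF s] s \<tau> by auto
      have "f (x + s *\<^sub>R v) \<le> f x + grad f (x + s *\<^sub>R v) \<bullet> (s *\<^sub>R v)"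
        using first_order[of "x + s *\<^sub>R v" x] P x by (simp add: P_def)
      also have "\<dots> \<le> f x + norm (grad f (x + s *\<^sub>R v)) * norm (s *\<^sub>R v)"
        using norm_cauchy_schwarz[of "grad f (x + s *\<^sub>R v)" "s *\<^sub>R v"] by simp
      also have "\<dots> \<le> f x + R * norm v"
        using P s1 R by (auto simp: P_def intro!: mult_mono mult_left_le_one_le)
      finally show ?thesis
        using P by (simp add: S_def P_def)
    qed
    moreover have "(\<lambda>s. x + s *\<^sub>R v) ` closure {0..<\<tau>} \<subseteq> closure ((\<lambda>s. x + s *\<^sub>R v) ` {0..<\<tau>})"
      by (intro image_closure_subset continuous_intros closure_subset) simp
    moreover have "\<tau> \<in> closure {0..<\<tau>}"
      using \<tau> False by simp
    ultimately have "x + \<tau> *\<^sub>R v \<in> S"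
      using closure_minimal[of "(\<lambda>s. x + s *\<^sub>R v) ` {0..<\<tau>}" S] by blast
    then show ?thesis
      by (simp add: S_def)
  qed (use x in simp)
  have "dist (grad f (x + \<tau> *\<^sub>R v)) (grad f x) \<le> l R * norm v * \<tau>"
  proof (rule grad_lipschitz_along_segment[OF \<tau>(1)])
    show "x + s *\<^sub>R v \<in> X" if "s \<in> {0..\<tau>}" for s
      using that before[of s] inX by (cases "s = \<tau>") (auto simp: P_def)
  qed (use before P_def in blast)
  also have "\<dots> \<le> l R * norm v"
    using \<tau> lR by (intro mult_left_le) auto
  finally have "norm (grad f (x + \<tau> *\<^sub>R v)) < R"
    using v norm_triangle_ineq2[of "grad f (x + \<tau> *\<^sub>R v)" "grad f x"] by (simp add: dist_norm)
  then obtain r where r: "r > 0" "\<And>y. y \<in> ball (x + \<tau> *\<^sub>R v) r \<Longrightarrow> y \<in> X \<and> norm (grad f y) < R"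
    using locally_lipschitz_below[OF inX] by (metis subsetD)
  \<comment> \<open>The good condition is open, so it persists beyond \<open>\<tau>\<close>, which contradicts the choice of \<open>\<tau>\<close>.\<close>
  define e where "e = r / (norm v + 1)"
  have n: "norm v + 1 > 0"
    by (simp add: add_nonneg_pos)
  have after: "P s" if s: "s \<in> {\<tau>..<\<tau> + e}" for s
  proof -
    have eq: "x + \<tau> *\<^sub>R v - (x + s *\<^sub>R v) = (\<tau> - s) *\<^sub>R v"
      by (simp add: algebra_simps)
    have "dist (x + \<tau> *\<^sub>R v) (x + s *\<^sub>R v) = (s - \<tau>) * norm v"
      unfolding dist_norm eq using s by simp
    also have "\<dots> \<le> (s - \<tau>) * (norm v + 1)"
      using s by (intro mult_left_mono) auto
    also have "\<dots> < e * (norm v + 1)"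
      using s n by (intro mult_strict_right_mono) auto
    finally show ?thesis
      using r n by (auto simp: e_def P_def)
  qed
  have "\<tau> + e \<le> \<tau>"
    unfolding \<tau>_def
  proof (rule cInf_greatest)
    show "bad \<noteq> {}"
      using t_bad by blast
    show "Inf bad + e \<le> s" if "s \<in> bad" for s
      using that before[of s] after[of s] by (force simp: bad_def \<tau>_def)
  qed
  moreover have "e > 0"
    using r(1) n by (simp add: e_def)
  ultimately show False
    by simp
qed

text \<open>
  The local form of smoothness on which everything rests: around a point of moderate gradient there
  is a ball of explicit radius inside \<open>X\<close>, on which the gradient is \<open>l R\<close>-Lipschitz in the usual sense.
\<close>

lemma ball_below:
  assumes x: "x \<in> X" and d: "norm (grad f x) + l R * d \<le> R" and R: "R \<ge> 0"
  shows ball_subset: "ball x d \<subseteq> X"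
    and norm_grad_less: "y \<in> ball x d \<Longrightarrow> norm (grad f y) < R"
    and grad_lipschitz: "(l R)-lipschitz_on (ball x d) (grad f)"
proof -
  have in_ball: "y \<in> X \<and> norm (grad f y) < R" if "y \<in> ball x d" for y
  proof -
    have "l R * norm (y - x) < l R * d"
      using that l_pos[OF R] by (simp add: dist_norm norm_minus_commute)
    then show ?thesis
      using segment_continuation[OF x R, of "y - x" 1] d by simp
  qed
  then show "ball x d \<subseteq> X" "y \<in> ball x d \<Longrightarrow> norm (grad f y) < R"
    by auto
  show "(l R)-lipschitz_on (ball x d) (grad f)"
  proof (rule lipschitz_onI)
    fix y z assume yz: "y \<in> ball x d" "z \<in> ball x d"
    have seg: "z + s *\<^sub>R (y - z) \<in> ball x d" if "s \<in> {0..1}" for s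
    proof -
      have "(1 - s) *\<^sub>R z + s *\<^sub>R y \<in> ball x d"
        using that yz by (intro convexD[OF convex_ball]) auto
      then show ?thesis by (simp add: algebra_simps)
    qed
    show "dist (grad f y) (grad f z) \<le> l R * dist y z"
      using grad_lipschitz_along_segment[of 1 z "y - z" R] in_ball[OF seg] by (simp add: dist_norm)
  qed (use l_pos[OF R] in simp)
qed

text \<open>
  The subgradient inequality at the new point, tested against \<open>x\<close>, bounds the new value by an inner
  product of the two gradients, which the Lipschitz bound compares with \<open>(norm (grad f x))\<^sup>2\<close>. This
  gives the factor \<open>1 - s L\<close> in place of the usual \<open>1 - s L / 2\<close>; for \<open>s L \<le> 1/2\<close> it is still at
  least \<open>1/2\<close>.
\<close>

lemma gradient_step_descent:
  assumes x: "x \<in> X" and y: "x - s *\<^sub>R grad f x \<in> X" and s: "s \<ge> 0"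
    and lip: "norm (grad f (x - s *\<^sub>R grad f x) - grad f x) \<le> L * norm (s *\<^sub>R grad f x)"
  shows "f (x - s *\<^sub>R grad f x) \<le> f x - s * (1 - s * L) * (norm (grad f x))\<^sup>2"
proof -
  let ?g = "grad f x" and ?y = "x - s *\<^sub>R grad f x"
  have "f ?y \<le> f x - s * (grad f ?y \<bullet> ?g)"
    using first_order[OF y x] by simp
  also have "grad f ?y \<bullet> ?g = (norm ?g)\<^sup>2 + (grad f ?y - ?g) \<bullet> ?g"
    by (simp add: inner_diff_left power2_norm_eq_inner)
  also have "f x - s * ((norm ?g)\<^sup>2 + (grad f ?y - ?g) \<bullet> ?g) \<le> f x - s * (1 - s * L) * (norm ?g)\<^sup>2"
  proof -
    have "- ((grad f ?y - ?g) \<bullet> ?g) \<le> norm (grad f ?y - ?g) * norm ?g"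
      by (metis inner_minus_left norm_cauchy_schwarz norm_minus_cancel)
    also have "\<dots> \<le> (L * norm (s *\<^sub>R ?g)) * norm ?g"
      using lip by (intro mult_right_mono) auto
    also have "\<dots> = s * L * (norm ?g)\<^sup>2"
      using s by (simp add: power2_eq_square)
    finally have "s * (- ((grad f ?y - ?g) \<bullet> ?g)) \<le> s * (s * L * (norm ?g)\<^sup>2)"
      using s by (rule mult_left_mono)
    then show ?thesis
      by (simp add: algebra_simps)
  qed
  finally show ?thesis .
qed

text \<open>
  A gradient step from \<open>x\<close> cannot go below the lower bound \<open>m\<close>, and it gains a multiple of the
  squared gradient norm; hence a small gap \<open>f x - m\<close> forces a small gradient. The slack between
  \<open>7/8 * R\<close> and \<open>R\<close> is what leaves room for a step on which \<open>l R\<close> controls the gradient.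
\<close>

lemma norm_grad_sq_le:
  assumes x: "x \<in> X" and R: "R > 0" and g: "norm (grad f x) \<le> 7/8 * R"
    and low: "\<And>y. y \<in> X \<Longrightarrow> m \<le> f y"
  shows "(norm (grad f x))\<^sup>2 \<le> 16 * l R * (f x - m)"
proof -
  let ?u = "norm (grad f x)"
  \<comment> \<open>The room for gradient growth is \<open>R/8\<close>, hence radius \<open>R / (8 * l R)\<close>; this step length stays inside.\<close>
  define s where "s = 1 / (8 * l R)"
  define y where "y = x - s *\<^sub>R grad f x"
  define d where "d = R / (8 * l R)"
  have L: "l R > 0"
    using l_pos[of R] R by simp
  have s: "s > 0" "s * l R = 1/8"
    using L by (simp_all add: s_def)
  have "s * ?u < s * R"
    using g R s by simp
  then have y: "y \<in> ball x d" "x \<in> ball x d"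
    using s R L by (auto simp: y_def d_def s_def dist_norm)
  have b: "?u + l R * d \<le> R"
    using g L by (simp add: d_def)
  note ball = ball_below[OF x b less_imp_le[OF R]]
  have yX: "y \<in> X"
    using ball(1) y by blast
  have "m \<le> f y"
    using low[OF yX] .
  also have "\<dots> \<le> f x - s * (1 - s * l R) * ?u\<^sup>2"
    unfolding y_def
  proof (rule gradient_step_descent[OF x])
    show "norm (grad f (x - s *\<^sub>R grad f x) - grad f x) \<le> l R * norm (s *\<^sub>R grad f x)"
      using lipschitz_onD[OF ball(3) y] by (simp add: y_def dist_norm)
  qed (use yX y_def s in auto)
  finally have "s * (7/8) * ?u\<^sup>2 \<le> f x - m"
    using s(2) by simp
  then have "7 * ?u\<^sup>2 \<le> 64 * l R * (f x - m)"
    using L by (simp add: s_def field_simps)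
  moreover have "0 \<le> l R * (f x - m)"
    using L low[OF x] by simp
  ultimately show ?thesis
    by (simp add: mult.assoc)
qed

end

section \<open>The weights of the method\<close>

text \<open>
  The weights \<open>a\<^sub>t\<close> of the method. They are the positive solutions of \<open>a\<^sup>2 = a + B\<^sub>t\<close>, which is what
  makes the potential below decrease.
\<close>

definition nag_weight :: "nat \<Rightarrow> real" where
  "nag_weight t = nag_B (Suc t) - nag_B t"

lemma nag_B_nonneg: "nag_B t \<ge> 0"
  by (induction t) (auto intro!: add_nonneg_nonneg)

lemma nag_B_ge: "nag_B t \<ge> (real t)\<^sup>2 / 4"
proof (induction t)
  case (Suc t)
  have "real t \<le> sqrt (4 * nag_B t + 1)"
    using Suc by (intro real_le_rsqrt) simp
  with Suc show ?case
    by (simp add: power2_eq_square field_simps)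
qed simp

lemma nag_weight_sq: "(nag_weight t)\<^sup>2 = nag_B (Suc t)"
proof -
  have "(sqrt (4 * nag_B t + 1))\<^sup>2 = 4 * nag_B t + 1"
    using nag_B_nonneg[of t] by simp
  then show ?thesis
    by (simp add: nag_weight_def power2_eq_square field_simps)
qed

lemma nag_weight_ge_1: "nag_weight t \<ge> 1"
  using nag_B_nonneg[of t] by (simp add: nag_weight_def)

lemma nag_weight_mono: "nag_weight t \<le> nag_weight (Suc t)"
proof -
  have "nag_B t \<le> nag_B (Suc t)"
    using nag_weight_ge_1[of t] by (simp add: nag_weight_def)
  then show ?thesis
    by (simp add: nag_weight_def)
qed

lemma nag_A_Suc: "nag_A \<eta> (Suc t) = nag_A \<eta> t + nag_weight t"
  by (simp add: nag_A_def nag_weight_def)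

lemma nag_A_Suc_eq_weight_sq: "nag_A \<eta> (Suc t) = (nag_weight t)\<^sup>2 + 1 / \<eta>"
  by (simp add: nag_A_def nag_weight_sq)

lemma nag_A_ge: "nag_A \<eta> t \<ge> 1 / \<eta>"
  using nag_B_nonneg by (simp add: nag_A_def)

text \<open>
  The fraction of the way from \<open>x\<^sub>t\<close> to \<open>z\<^sub>t\<close> at which \<open>y\<^sub>t\<close> lies. With \<open>b = a\<^sub>t\<^sup>2\<close> it is
  \<open>sqrt b / (b + 1/\<eta>)\<close>, at most \<open>sqrt \<eta> / 2\<close> by the inequality of arithmetic and geometric means. This is
  where the offset \<open>1/\<eta>\<close> in \<open>A\<^sub>t\<close> pays off.
\<close>

lemma nag_extrapolation_small:
  assumes "\<eta> > 0"
  shows "(nag_weight t / nag_A \<eta> (Suc t))\<^sup>2 \<le> \<eta> / 4"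
proof -
  let ?b = "(nag_weight t)\<^sup>2" and ?A = "nag_A \<eta> (Suc t)"
  have A: "?A > 0"
    using nag_A_ge[of \<eta> "Suc t"] assms by (smt (verit) divide_pos_pos)
  have "4 * ?b * (1 / \<eta>) \<le> (?b + 1 / \<eta>)\<^sup>2"
    using zero_le_power2[of "?b - 1 / \<eta>"] by (simp add: power2_diff power2_sum)
  then have "4 * ?b \<le> \<eta> * ?A\<^sup>2"
    using assms by (simp add: nag_A_Suc_eq_weight_sq field_simps)
  then show ?thesis
    using A by (simp add: power_divide field_simps)
qed

section \<open>One step of the method\<close>

text \<open>
  The point \<open>x\<^sub>t\<close> is a convex combination of the points \<open>z\<^sub>0, \<dots>, z\<^sub>t\<close>, with weight \<open>c\<^sub>t\<close> on the
  last of them, where \<open>c\<^sub>0 = 1\<close> and \<open>c\<^sub>t\<^sub>+\<^sub>1 = 1 / a\<^sub>t\<close>. Eliminating the gradient between the updates of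
  \<open>x\<close> and \<open>z\<close> gives \<open>x' - z'/a = (A/A') (x - c z) + (k/A') z\<close>, and nonnegativity of \<open>k\<close> keeps all
  weights nonnegative. Hence a bound on the distances of the \<open>z\<^sub>t\<close> from \<open>s\<close> carries over to the \<open>x\<^sub>t\<close>,
  which is stated here for the part of \<open>x\<close> that does not come from the current \<open>z\<close>.
\<close>

lemma nag_average_step:
  fixes x z g s :: "'a::real_normed_vector"
  assumes A: "A \<ge> 0" and a: "a > 0" and A': "A' = A + a"
    and y: "y = x + (1 - A / A') *\<^sub>R (z - x)"
    and x': "x' = y - \<eta> *\<^sub>R g" and z': "z' = z - (\<eta> * a) *\<^sub>R g"
    and k: "A * c + a - A' / a \<ge> 0"
    and avg: "norm ((x - s) - c *\<^sub>R (z - s)) \<le> (1 - c) * \<rho>" and z: "norm (z - s) \<le> \<rho>"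
  shows "norm ((x' - s) - (1 / a) *\<^sub>R (z' - s)) \<le> (1 - 1 / a) * \<rho>"
proof -
  define k where "k = A * c + a - A' / a"
  have A'pos: "A' > 0"
    using A a A' by simp
  have w: "1 - A / A' = a / A'"
    using A'pos A' by (simp add: field_simps)
  define p q where "p = x - s" and "q = z - s"
  have "(x' - s) - (1 / a) *\<^sub>R (z' - s) = p + (a / A') *\<^sub>R (q - p) - (1 / a) *\<^sub>R q"
    using a by (simp add: x' z' y w p_def q_def scaleR_diff_right)
  also have "\<dots> = (1 - a / A') *\<^sub>R p + (a / A' - 1 / a) *\<^sub>R q"
    by (simp add: algebra_simps)
  also have "1 - a / A' = A / A'"
    using w by simp
  also have "a / A' - 1 / a = k / A' - A / A' * c"
    using A'pos a by (simp add: k_def field_simps)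
  also have "(A / A') *\<^sub>R p + (k / A' - A / A' * c) *\<^sub>R q = (A / A') *\<^sub>R (p - c *\<^sub>R q) + (k / A') *\<^sub>R q"
    by (simp add: algebra_simps)
  also have "norm \<dots> \<le> A / A' * norm (p - c *\<^sub>R q) + k / A' * norm q"
    using A A'pos k k_def by (intro norm_triangle_le) simp
  also have "\<dots> \<le> A / A' * ((1 - c) * \<rho>) + k / A' * \<rho>"
    using A A'pos k k_def avg z by (intro add_mono mult_left_mono) (simp_all add: p_def q_def)
  also have "\<dots> = (A * (1 - c) + k) / A' * \<rho>"
    using A'pos by (simp add: field_simps)
  also have "A * (1 - c) + k = A' * (1 - 1 / a)"
    by (simp add: k_def A' algebra_simps)
  also have "A' * (1 - 1 / a) / A' = 1 - 1 / a"
    using A'pos by simp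
  finally show ?thesis .
qed

context ell_smooth_convex
begin

text \<open>
  The standard potential argument. The subgradient inequality at \<open>y\<close> is used towards \<open>x\<close> with weight
  \<open>A\<close> and towards \<open>s\<close> with weight \<open>a\<close>. The first-order terms cancel because \<open>y\<close> is the \<open>A : a\<close>
  average of \<open>x\<close> and \<open>z\<close>, and \<open>a\<^sup>2 \<le> A'\<close> lets the descent pay for the squared gradient that the
  update of \<open>z\<close> produces.
\<close>

lemma nag_potential_step:
  assumes X: "x \<in> X" "y \<in> X" "s \<in> X" and A: "A \<ge> 0" and a: "a \<ge> 0" and A': "A' = A + a" "A' > 0"
    and \<eta>: "\<eta> > 0" and aA: "a\<^sup>2 \<le> A'"
    and y: "y = x + (1 - A / A') *\<^sub>R (z - x)"
    and z': "z' = z - (\<eta> * a) *\<^sub>R grad f y"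
    and descent: "f x' \<le> f y - \<eta> / 2 * (norm (grad f y))\<^sup>2"
  shows "A' * (f x' - f s) + (norm (z' - s))\<^sup>2 / (2 * \<eta>) \<le> A * (f x - f s) + (norm (z - s))\<^sup>2 / (2 * \<eta>)"
proof -
  define g where "g = grad f y"
  have "A' *\<^sub>R y = A' *\<^sub>R x + (A' - A) *\<^sub>R (z - x)"
    using A'(2) by (simp add: y scaleR_add_right right_diff_distrib)
  then have "A *\<^sub>R (x - y) + a *\<^sub>R (z - y) = 0"
    by (simp add: A' algebra_simps)
  then have "g \<bullet> (A *\<^sub>R (x - y) + a *\<^sub>R (z - y)) = 0"
    by simp
  then have orth: "A * (g \<bullet> (x - y)) + a * (g \<bullet> (z - y)) = 0"
    by (simp add: inner_add_right)
  have x: "A * (f y + g \<bullet> (x - y)) \<le> A * f x"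
    using first_order[OF X(2,1)] A by (intro mult_left_mono) (simp_all add: g_def)
  have s: "a * (f y + g \<bullet> (s - y)) \<le> a * f s"
    using first_order[OF X(2,3)] a by (intro mult_left_mono) (simp_all add: g_def)
  have "A' * f x' \<le> A' * (f y - \<eta> / 2 * (norm g)\<^sup>2)"
    using descent A'(2) by (simp add: g_def)
  also have "\<dots> \<le> A' * f y - \<eta> / 2 * a\<^sup>2 * (norm g)\<^sup>2"
  proof -
    have "a\<^sup>2 * (\<eta> / 2 * (norm g)\<^sup>2) \<le> A' * (\<eta> / 2 * (norm g)\<^sup>2)"
      using aA \<eta> by (intro mult_right_mono) simp_all
    then show ?thesis
      by (simp add: algebra_simps)
  qed
  finally have x': "A' * f x' \<le> A * f y + a * f y - \<eta> / 2 * a\<^sup>2 * (norm g)\<^sup>2"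
    by (simp add: A' algebra_simps)
  have norm_sq: "(norm (p - (\<eta> * a) *\<^sub>R g))\<^sup>2 = (norm p)\<^sup>2 - 2 * \<eta> * a * (g \<bullet> p) + (\<eta> * a)\<^sup>2 * (norm g)\<^sup>2"
    for p
    by (simp only: power2_norm_eq_inner)
      (simp add: inner_diff_left inner_diff_right inner_commute power2_eq_square algebra_simps)
  have "z' - s = (z - s) - (\<eta> * a) *\<^sub>R g"
    by (simp add: z' g_def)
  then have "(norm (z' - s))\<^sup>2 = (norm (z - s))\<^sup>2 - 2 * \<eta> * a * (g \<bullet> (z - s)) + (\<eta> * a)\<^sup>2 * (norm g)\<^sup>2"
    by (simp only: norm_sq)
  then have "(norm (z' - s))\<^sup>2 / (2 * \<eta>)
      = (norm (z - s))\<^sup>2 / (2 * \<eta>) - a * (g \<bullet> (z - s)) + \<eta> / 2 * a\<^sup>2 * (norm g)\<^sup>2"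
    using \<eta> by (simp add: field_simps power2_eq_square)
  moreover have "g \<bullet> (z - s) = g \<bullet> (z - y) - g \<bullet> (s - y)"
    by (simp add: inner_diff_right)
  ultimately have z: "(norm (z' - s))\<^sup>2 / (2 * \<eta>)
      = (norm (z - s))\<^sup>2 / (2 * \<eta>) - (a * (g \<bullet> (z - y)) - a * (g \<bullet> (s - y))) + \<eta> / 2 * a\<^sup>2 * (norm g)\<^sup>2"
    by (simp add: right_diff_distrib)
  have "A' * f s = A * f s + a * f s"
    by (simp add: A' algebra_simps)
  then show ?thesis
    using orth x s x' z by (simp add: algebra_simps)
qed

text \<open>
  Everything in one iteration happens in the ball of radius \<open>d = G / L\<close> around \<open>x\<close>, on which gradients
  are below \<open>2 G\<close> and \<open>L\<close>-Lipschitz: \<open>y\<close> is at distance at most \<open>d/8\<close>, and the gradient step from \<open>y\<close>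
  has length at most \<open>9/16 * d\<close>. The new gradient norm need not be below \<open>G\<close>, but it stays
  clear of \<open>2 G\<close>.
\<close>

lemma nag_local_step:
  assumes x: "x \<in> X" and G: "G > 0" "norm (grad f x) \<le> G"
    and \<eta>: "0 < \<eta>" "\<eta> \<le> 1 / (2 * l (2 * G))" and y: "norm (y - x) \<le> G / (8 * l (2 * G))"
    and x': "x' = y - \<eta> *\<^sub>R grad f y"
  shows "y \<in> X \<and> x' \<in> X \<and> norm (grad f x') \<le> 7/4 * G
    \<and> f x' \<le> f y - \<eta> / 2 * (norm (grad f y))\<^sup>2"
proof -
  define L where "L = l (2 * G)"
  have L: "L > 0"
    using l_pos[of "2 * G"] G by (simp add: L_def)
  define d where "d = G / L"
  have d: "d > 0" "L * d = G"
    using G L by (simp_all add: d_def)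
  have yd: "norm (y - x) \<le> d / 8"
    using y by (simp add: d_def L_def)
  have \<eta>L: "\<eta> * L \<le> 1 / 2"
    using \<eta> L by (simp add: L_def field_simps)
  have b: "norm (grad f x) + l (2 * G) * d \<le> 2 * G"
    using G d by (simp add: L_def)
  have "2 * G \<ge> 0"
    using G by simp
  note ball = ball_below[OF x b this, folded L_def]
  have xb: "x \<in> ball x d" and yb: "y \<in> ball x d"
    using d yd by (auto simp: dist_norm norm_minus_commute)
  have lip: "norm (grad f v - grad f u) \<le> L * norm (v - u)" if "u \<in> ball x d" "v \<in> ball x d" for u v
    using lipschitz_onD[OF ball(3) that(2,1)] by (simp add: dist_norm)
  have near: "norm (grad f v) \<le> G + L * norm (v - x)" if "v \<in> ball x d" for v
    using lip[OF xb that] norm_triangle_ineq2[of "grad f v" "grad f x"] G by linarith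
  have "norm (grad f y) \<le> G + L * (d / 8)"
    using near[OF yb] mult_left_mono[OF yd, of L] L by linarith
  then have gy: "norm (grad f y) \<le> 9/8 * (L * d)"
    using d by simp
  have "norm (x' - y) = \<eta> * norm (grad f y)"
    using \<eta> by (simp add: x')
  also have "\<dots> \<le> \<eta> * (9/8 * (L * d))"
    using gy \<eta> by (intro mult_left_mono) auto
  also have "\<dots> = (\<eta> * L) * (9/8 * d)"
    by simp
  also have "\<dots> \<le> 1/2 * (9/8 * d)"
    using \<eta>L d by (intro mult_right_mono) auto
  finally have x'd: "norm (x' - x) \<le> 11/16 * d"
    using yd norm_triangle_ineq[of "x' - y" "y - x"] by simp
  then have x'b: "x' \<in> ball x d"
    using d by (auto simp: dist_norm norm_minus_commute)
  have inX: "y \<in> X" "x' \<in> X"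
    using ball(1) yb x'b by auto
  have "norm (grad f x') \<le> G + L * (11/16 * d)"
    using near[OF x'b] mult_left_mono[OF x'd, of L] L by linarith
  also have "L * (11/16 * d) = 11/16 * G"
    using d by simp
  finally have gx': "norm (grad f x') \<le> 7/4 * G"
    using G by simp
  have "f x' \<le> f y - \<eta> * (1 - \<eta> * L) * (norm (grad f y))\<^sup>2"
    unfolding x'
  proof (rule gradient_step_descent)
    show "norm (grad f (y - \<eta> *\<^sub>R grad f y) - grad f y) \<le> L * norm (\<eta> *\<^sub>R grad f y)"
      using lip[OF yb x'b] by (simp add: x')
  qed (use inX x' \<eta> in auto)
  also have "\<dots> \<le> f y - \<eta> / 2 * (norm (grad f y))\<^sup>2"
  proof -
    have "\<eta> * (1 / 2) * (norm (grad f y))\<^sup>2 \<le> \<eta> * (1 - \<eta> * L) * (norm (grad f y))\<^sup>2"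
      using \<eta> \<eta>L by (intro mult_right_mono mult_left_mono) auto
    then show ?thesis by simp
  qed
  finally show ?thesis
    using inX gx' by simp
qed

section \<open>The iterates stay in the region of moderate gradients\<close>

text \<open>
  The induction that keeps the iterates where the smoothness constant is \<open>L = l (2 G)\<close>. The potential
  bound puts every \<open>z\<^sub>t\<close> within \<open>sqrt (2 D)\<close> of \<open>s\<close>; by the averaging invariant so is \<open>x\<^sub>t\<close>, and
  \<open>y\<^sub>t\<close> is therefore within \<open>sqrt (2 D \<eta>) \<le> G / (8 L)\<close> of \<open>x\<^sub>t\<close>. This makes the next step local. It gives a
  gradient norm of at most \<open>7/4 * G\<close>, which the bound \<open>D\<close> on the function gap, again from the
  potential, improves to \<open>G\<close>.
\<close>

lemma nag_invariant:
  assumes x0: "x0 \<in> X" and s: "s \<in> X" and low: "\<And>x. x \<in> X \<Longrightarrow> f s \<le> f x"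
    and G: "G > 0" "norm (grad f x0) \<le> G"
    and D: "D = (f x0 - f s) + (norm (x0 - s))\<^sup>2" "64 * l (2 * G) * D \<le> G\<^sup>2"
    and \<eta>: "0 < \<eta>" "\<eta> \<le> 1 / (2 * l (2 * G))"
  defines "x \<equiv> nag_x (grad f) \<eta> x0" and "y \<equiv> nag_y (grad f) \<eta> x0" and "z \<equiv> nag_z (grad f) \<eta> x0"
    and "c \<equiv> \<lambda>t. case t of 0 \<Rightarrow> 1 | Suc k \<Rightarrow> 1 / nag_weight k"
  shows "x t \<in> X \<and> y t \<in> X \<and> norm (grad f (x t)) \<le> G
    \<and> nag_A \<eta> t * (f (x t) - f s) + (norm (z t - s))\<^sup>2 / (2 * \<eta>) \<le> D / \<eta>
    \<and> norm ((x t - s) - c t *\<^sub>R (z t - s)) \<le> (1 - c t) * sqrt (2 * D)"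
proof -
  define L where "L = l (2 * G)"
  define Inv where "Inv t \<longleftrightarrow> x t \<in> X \<and> norm (grad f (x t)) \<le> G
    \<and> nag_A \<eta> t * (f (x t) - f s) + (norm (z t - s))\<^sup>2 / (2 * \<eta>) \<le> D / \<eta>
    \<and> norm ((x t - s) - c t *\<^sub>R (z t - s)) \<le> (1 - c t) * sqrt (2 * D)" for t
  have L: "L > 0"
    using l_pos[of "2 * G"] G by (simp add: L_def)
  have D0: "D \<ge> 0"
    using low[OF x0] by (simp add: D)
  have A: "nag_A \<eta> t > 0" for t
    using nag_A_ge[of \<eta> t] \<eta> by (smt (verit) divide_pos_pos)
  have c: "0 \<le> c t" "c t \<le> 1" "1 / nag_weight t \<le> c t" for t
    using nag_weight_ge_1[of t] nag_weight_ge_1[of "t - 1"] nag_weight_mono[of "t - 1"]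
    by (cases t; simp add: c_def frac_le)+
  have near: "norm (z t - s) \<le> sqrt (2 * D) \<and> norm (y t - x t) \<le> G / (8 * L)" if "Inv t" for t
  proof -
    have "nag_A \<eta> t * (f (x t) - f s) \<ge> 0"
      using A[of t] low[of "x t"] that by (simp add: Inv_def)
    then have "(norm (z t - s))\<^sup>2 / (2 * \<eta>) \<le> D / \<eta>"
      using that by (simp add: Inv_def)
    then have "(norm (z t - s))\<^sup>2 \<le> 2 * D"
      using \<eta> by (simp add: field_simps)
    then have z: "norm (z t - s) \<le> sqrt (2 * D)"
      by (rule real_le_rsqrt)
    have "z t - x t = (1 - c t) *\<^sub>R (z t - s) - ((x t - s) - c t *\<^sub>R (z t - s))"
      by (simp add: algebra_simps)
    then have "norm (z t - x t) \<le> norm ((1 - c t) *\<^sub>R (z t - s)) + norm ((x t - s) - c t *\<^sub>R (z t - s))"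
      using norm_triangle_ineq4 by metis
    also have "\<dots> \<le> (1 - c t) * sqrt (2 * D) + (1 - c t) * sqrt (2 * D)"
      using that z c[of t] by (intro add_mono) (auto simp: Inv_def intro: mult_left_mono)
    also have "\<dots> \<le> 2 * sqrt (2 * D)"
      using c[of t] D0 mult_left_le_one_le[of "sqrt (2 * D)" "1 - c t"] by simp
    finally have "(norm (z t - x t))\<^sup>2 \<le> (2 * sqrt (2 * D))\<^sup>2"
      by (intro power_mono) auto
    then have zx: "(norm (z t - x t))\<^sup>2 \<le> 8 * D"
      using D0 by (simp add: power_mult_distrib)
    have "1 - nag_A \<eta> t / nag_A \<eta> (Suc t) = nag_weight t / nag_A \<eta> (Suc t)"
      using A[of "Suc t"] by (simp add: nag_A_Suc field_simps)
    then have "y t - x t = (nag_weight t / nag_A \<eta> (Suc t)) *\<^sub>R (z t - x t)"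
      by (simp add: y_def x_def z_def)
    then have "(norm (y t - x t))\<^sup>2 = (nag_weight t / nag_A \<eta> (Suc t))\<^sup>2 * (norm (z t - x t))\<^sup>2"
      by (simp add: power_mult_distrib power_divide)
    also have "\<dots> \<le> \<eta> / 4 * (8 * D)"
      using nag_extrapolation_small[OF \<eta>(1)] zx \<eta> by (intro mult_mono) auto
    also have "\<dots> \<le> (1 / (2 * L)) * (2 * D)"
      using \<eta> D0 mult_right_mono[of \<eta> "1 / (2 * L)" "2 * D"] by (simp add: L_def mult_ac)
    also have "\<dots> \<le> (G / (8 * L))\<^sup>2"
      using D(2) L by (simp add: L_def power2_eq_square field_simps)
    finally have "norm (y t - x t) \<le> G / (8 * L)"
      by (rule power2_le_imp_le) (use G L in simp)
    with z show ?thesis by simp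
  qed
  have step: "y t \<in> X \<and> Inv (Suc t)" if inv: "Inv t" for t
  proof -
    have xt: "x t \<in> X" "norm (grad f (x t)) \<le> G"
      using inv by (auto simp: Inv_def)
    have x': "x (Suc t) = y t - \<eta> *\<^sub>R grad f (y t)"
      by (simp add: x_def y_def)
    have y: "y t = x t + (1 - nag_A \<eta> t / nag_A \<eta> (Suc t)) *\<^sub>R (z t - x t)"
      by (simp add: x_def y_def z_def)
    have z': "z (Suc t) = z t - (\<eta> * nag_weight t) *\<^sub>R grad f (y t)"
      by (simp add: z_def y_def nag_A_Suc)
    have loc: "y t \<in> X" "x (Suc t) \<in> X" "norm (grad f (x (Suc t))) \<le> 7/4 * G"
      "f (x (Suc t)) \<le> f (y t) - \<eta> / 2 * (norm (grad f (y t)))\<^sup>2"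
      using nag_local_step[OF xt(1) G(1) xt(2) \<eta> _ x'] near[OF inv] by (auto simp: L_def)
    have a: "nag_weight t > 0"
      using nag_weight_ge_1[of t] by simp
    have "nag_A \<eta> (Suc t) * (f (x (Suc t)) - f s) + (norm (z (Suc t) - s))\<^sup>2 / (2 * \<eta>)
        \<le> nag_A \<eta> t * (f (x t) - f s) + (norm (z t - s))\<^sup>2 / (2 * \<eta>)"
      by (rule nag_potential_step[OF xt(1) loc(1) s _ _ nag_A_Suc A \<eta>(1) _ y z' loc(4)])
        (use A[of t] a \<eta> in \<open>simp_all add: nag_A_Suc_eq_weight_sq\<close>)
    then have pot: "nag_A \<eta> (Suc t) * (f (x (Suc t)) - f s) + (norm (z (Suc t) - s))\<^sup>2 / (2 * \<eta>) \<le> D / \<eta>"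
      using inv by (simp add: Inv_def)
    have "(1 / \<eta>) * (f (x (Suc t)) - f s) \<le> nag_A \<eta> (Suc t) * (f (x (Suc t)) - f s)"
      using nag_A_ge[of \<eta> "Suc t"] low[OF loc(2)] by (intro mult_right_mono) auto
    also have "\<dots> \<le> (1 / \<eta>) * D"
    proof -
      have "(norm (z (Suc t) - s))\<^sup>2 / (2 * \<eta>) \<ge> 0"
        using \<eta> by simp
      then show ?thesis
        using pot by simp
    qed
    finally have val: "f (x (Suc t)) - f s \<le> D"
      using \<eta> by (simp add: divide_le_cancel)
    have "(norm (grad f (x (Suc t))))\<^sup>2 \<le> 16 * L * (f (x (Suc t)) - f s)"
      unfolding L_def
      by (rule norm_grad_sq_le[OF loc(2)]) (use G loc(3) low in auto)
    also have "\<dots> \<le> 16 * L * D"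
      using val L by simp
    also have "\<dots> \<le> G\<^sup>2"
      using D(2) mult_nonneg_nonneg[OF less_imp_le[OF L] D0] unfolding L_def by linarith
    finally have gr: "norm (grad f (x (Suc t))) \<le> G"
      by (rule power2_le_imp_le) (use G in simp)
    \<comment> \<open>The nonnegativity condition of the averaging step; at \<open>t = 0\<close> it holds with equality.\<close>
    have "nag_A \<eta> (Suc t) / nag_weight t = nag_weight t + (1 / \<eta>) * (1 / nag_weight t)"
      using a by (simp add: nag_A_Suc_eq_weight_sq power2_eq_square field_simps)
    moreover have "(1 / \<eta>) * (1 / nag_weight t) \<le> nag_A \<eta> t * c t"
      using nag_A_ge[of \<eta> t] c[of t] a A[of t] by (intro mult_mono) auto
    ultimately have k: "nag_A \<eta> t * c t + nag_weight t - nag_A \<eta> (Suc t) / nag_weight t \<ge> 0"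
      by simp
    have "norm ((x (Suc t) - s) - (1 / nag_weight t) *\<^sub>R (z (Suc t) - s)) \<le> (1 - 1 / nag_weight t) * sqrt (2 * D)"
      by (rule nag_average_step[OF less_imp_le[OF A] a nag_A_Suc y x' z' k])
        (use inv near[OF inv] in \<open>auto simp: Inv_def\<close>)
    then have "norm ((x (Suc t) - s) - c (Suc t) *\<^sub>R (z (Suc t) - s)) \<le> (1 - c (Suc t)) * sqrt (2 * D)"
      by (simp add: c_def)
    then show ?thesis
      using loc pot gr by (simp add: Inv_def)
  qed
  have "Inv 0"
    using x0 G \<eta> zero_le_power2[of "norm (x0 - s)"]
    by (simp add: Inv_def x_def z_def c_def nag_A_def D field_simps)
  then have inv: "Inv t" for t
    by (induction t) (simp_all add: step)
  show ?thesis
    using inv[of t] step[OF inv, of t] by (simp add: Inv_def)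
qed

end

section \<open>Convergence\<close>

text \<open>
  With \<open>l (2 G) \<le> 4 \<epsilon> G\<^sup>2\<close> the square of the required lower bound is at most \<open>256 \<epsilon> D G\<^sup>2\<close>, so any
  sufficiently large \<open>G\<close> will do once \<open>256 \<epsilon> D \<le> 1\<close>.
\<close>

lemma subquadratic_imp_self_bounding_radius:
  assumes "subquadratic l" and D: "D \<ge> 0"
  shows "\<exists>G. G \<ge> max (8 * sqrt (l (2 * G) * D)) K"
proof -
  define e where "e = 1 / (256 * D + 1)"
  have e: "e > 0" "256 * e * D \<le> 1"
    using D by (simp_all add: e_def)
  have "\<forall>\<^sub>F u in at_top. l u / u\<^sup>2 < e"
    using assms(1) e unfolding subquadratic_def by (intro order_tendstoD(2))
  then obtain N where N: "\<And>u. u \<ge> N \<Longrightarrow> l u / u\<^sup>2 < e"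
    by (auto simp: eventually_at_top_linorder)
  define G where "G = max 1 (max N K)"
  have G: "G \<ge> 1" "2 * G \<ge> N" "G \<ge> K"
    by (auto simp: G_def)
  have "l (2 * G) \<le> e * (2 * G)\<^sup>2"
    using N[OF G(2)] G by (simp add: pos_divide_less_eq less_imp_le)
  then have "64 * (l (2 * G) * D) \<le> 64 * (e * (2 * G)\<^sup>2 * D)"
    using D by (intro mult_left_mono mult_right_mono) auto
  also have "\<dots> = (256 * e * D) * G\<^sup>2"
    by (simp add: power2_eq_square)
  also have "\<dots> \<le> G\<^sup>2"
    using e(2) mult_right_mono[of "256 * e * D" 1 "G\<^sup>2"] by simp
  finally have "l (2 * G) * D \<le> (G / 8)\<^sup>2"
    by (simp add: power_divide)
  then have "sqrt (l (2 * G) * D) \<le> G / 8"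
    using G by (intro real_le_lsqrt) auto
  then show ?thesis
    using G by (intro exI[of _ G]) auto
qed

lemma nag_stationary:
  assumes "g x0 = 0"
  shows "nag_x g \<eta> x0 t = x0 \<and> nag_y g \<eta> x0 t = x0 \<and> nag_z g \<eta> x0 t = x0"
  by (induction t) (use assms in simp_all)

context ell_smooth_convex
begin

text \<open>
  The potential bounds \<open>A\<^sub>t (f x\<^sub>t - f s)\<close> by \<open>D / \<eta>\<close>, and \<open>\<eta> A\<^sub>t = \<eta> B\<^sub>t + 1\<close> with
  \<open>B\<^sub>t \<ge> t\<^sup>2 / 4\<close>. The degenerate radius \<open>G = 0\<close>, for which the balls of the local analysis are empty, is the
  case of a start at a minimizer, where the method does not move.
\<close>

lemma nag_convergence:
  assumes x0: "x0 \<in> X" and s: "s \<in> X" and low: "\<And>x. x \<in> X \<Longrightarrow> f s \<le> f x"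
    and D: "D = (f x0 - f s) + (norm (x0 - s))\<^sup>2"
    and G: "G \<ge> 8 * sqrt (l (2 * G) * D)" "norm (grad f x0) \<le> G"
    and \<eta>: "0 < \<eta>" "\<eta> \<le> 1 / (2 * l (2 * G))"
  shows "nag_x (grad f) \<eta> x0 t \<in> X" "nag_y (grad f) \<eta> x0 t \<in> X"
    and "f (nag_x (grad f) \<eta> x0 t) - f s \<le> 4 * D / (\<eta> * (real t)\<^sup>2 + 4)"
proof -
  have D0: "D \<ge> 0"
    using low[OF x0] by (simp add: D)
  have G0: "G \<ge> 0"
    using G(2) norm_ge_zero order_trans by blast
  then have L: "l (2 * G) > 0"
    by (intro l_pos) simp
  have "(8 * sqrt (l (2 * G) * D))\<^sup>2 \<le> G\<^sup>2"
    using G(1) L D0 by (intro power_mono) auto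
  then have GD: "64 * l (2 * G) * D \<le> G\<^sup>2"
    using L D0 by (simp add: power_mult_distrib)
  have pos: "\<eta> * (real t)\<^sup>2 + 4 > 0"
    using \<eta> by (intro add_nonneg_pos) auto
  have "nag_x (grad f) \<eta> x0 t \<in> X \<and> nag_y (grad f) \<eta> x0 t \<in> X
    \<and> f (nag_x (grad f) \<eta> x0 t) - f s \<le> 4 * D / (\<eta> * (real t)\<^sup>2 + 4)"
  proof (cases "G = 0")
    case True
    then have "grad f x0 = 0" and "l 0 * D \<le> 0"
      using G(2) GD by (auto simp: mult.commute)
    then have "D = 0"
      using D0 L True by (simp add: mult_le_0_iff)
    then have "f x0 = f s"
      using D low[OF x0] zero_le_power2[of "norm (x0 - s)"] by linarith
    then show ?thesis
      using nag_stationary[of "grad f" x0 \<eta> t] \<open>grad f x0 = 0\<close> x0 \<open>D = 0\<close> by simp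
  next
    case False
    then have "G > 0"
      using G0 by simp
    note inv = nag_invariant[OF x0 s low this G(2) D GD \<eta>, of t]
    let ?A = "nag_A \<eta> t" and ?\<delta> = "f (nag_x (grad f) \<eta> x0 t) - f s"
    have "0 \<le> ?\<delta>"
      using inv low by simp
    have "?A * ?\<delta> + (norm (nag_z (grad f) \<eta> x0 t - s))\<^sup>2 / (2 * \<eta>) \<le> D / \<eta>"
      using inv by simp
    moreover have "(norm (nag_z (grad f) \<eta> x0 t - s))\<^sup>2 / (2 * \<eta>) \<ge> 0"
      using \<eta> by simp
    ultimately have "?A * ?\<delta> \<le> D / \<eta>"
      by linarith
    then have "\<eta> * (?A * ?\<delta>) \<le> D"
      using \<eta> by (simp add: pos_le_divide_eq mult.commute)
    moreover have "\<eta> * (real t)\<^sup>2 + 4 \<le> 4 * (\<eta> * ?A)"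
      using mult_left_mono[OF nag_B_ge[of t], of \<eta>] \<eta> by (simp add: nag_A_def distrib_left)
    then have "(\<eta> * (real t)\<^sup>2 + 4) * ?\<delta> \<le> 4 * (\<eta> * ?A) * ?\<delta>"
      using \<open>0 \<le> ?\<delta>\<close> by (rule mult_right_mono)
    moreover have "4 * (\<eta> * ?A) * ?\<delta> = 4 * (\<eta> * (?A * ?\<delta>))"
      by simp
    ultimately have "(\<eta> * (real t)\<^sup>2 + 4) * ?\<delta> \<le> 4 * D"
      by linarith
    then have "?\<delta> * (\<eta> * (real t)\<^sup>2 + 4) \<le> 4 * D"
      by (simp only: mult.commute)
    then show ?thesis
      using inv pos by (simp add: pos_le_divide_eq)
  qed
  then show "nag_x (grad f) \<eta> x0 t \<in> X" "nag_y (grad f) \<eta> x0 t \<in> X"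
    "f (nag_x (grad f) \<eta> x0 t) - f s \<le> 4 * D / (\<eta> * (real t)\<^sup>2 + 4)"
    by blast+
qed

end

theorem theorem4p4:
  fixes X :: "'a::euclidean_space set"
    and f :: "'a \<Rightarrow> real"
    and l :: "real \<Rightarrow> real"
    and fstar :: real
    and x0 xstar :: 'a
  assumes "open X"
    and "\<forall>x\<in>X. f differentiable (at x)"
    and "closed_sublevels X f"
    and "bdd_below (f ` X)"
    and "fstar = (INF x\<in>X. f x)"
    and "xstar \<in> X" and "f xstar = fstar"
    and "convex_diff X f"
    and "growth_fun l" and "subquadratic l"
    and "ell_smooth X f l"
    and "x0 \<in> X"
  shows "(\<exists>G. G \<ge> max (8 * sqrt (l (2 * G) * ((f x0 - fstar) + (norm (x0 - xstar))\<^sup>2)))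
                      (norm (grad f x0)))
    \<and> (\<forall>G L \<eta>.
          G \<ge> max (8 * sqrt (l (2 * G) * ((f x0 - fstar) + (norm (x0 - xstar))\<^sup>2)))
                  (norm (grad f x0))
          \<and> L = l (2 * G) \<and> 0 < \<eta> \<and> \<eta> \<le> min (1 / (16 * L\<^sup>2)) (1 / (2 * L))
          \<longrightarrow> (\<forall>t. nag_x (grad f) \<eta> x0 t \<in> X \<and> nag_y (grad f) \<eta> x0 t \<in> X)
            \<and> (\<forall>T. f (nag_x (grad f) \<eta> x0 T) - fstar
                     \<le> (4 * (f x0 - fstar) + 4 * (norm (x0 - xstar))\<^sup>2)
                        / (\<eta> * (real T)\<^sup>2 + 4)))"
proof -
  interpret ell_smooth_convex X f l
    using assms by unfold_locales
  define D where "D = (f x0 - f xstar) + (norm (x0 - xstar))\<^sup>2"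
  have low: "f xstar \<le> f x" if "x \<in> X" for x
    using cINF_lower[OF assms(4) that] assms(5,7) by simp
  have D: "D \<ge> 0"
    using low[OF assms(12)] by (simp add: D_def)
  have num: "4 * (f x0 - f xstar) + 4 * (norm (x0 - xstar))\<^sup>2 = 4 * D"
    by (simp add: D_def)
  show ?thesis
    unfolding assms(7)[symmetric] num D_def[symmetric]
  proof (intro conjI allI impI)
    show "\<exists>G. G \<ge> max (8 * sqrt (l (2 * G) * D)) (norm (grad f x0))"
      using subquadratic_imp_self_bounding_radius[OF assms(10) D] .
  next
    fix G L \<eta> t
    assume *: "G \<ge> max (8 * sqrt (l (2 * G) * D)) (norm (grad f x0))
      \<and> L = l (2 * G) \<and> 0 < \<eta> \<and> \<eta> \<le> min (1 / (16 * L\<^sup>2)) (1 / (2 * L))"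
    then have "G \<ge> 8 * sqrt (l (2 * G) * D)" "norm (grad f x0) \<le> G" "0 < \<eta>" "\<eta> \<le> 1 / (2 * l (2 * G))"
      by auto
    note conv = nag_convergence[OF assms(12,6) low D_def this]
    show "nag_x (grad f) \<eta> x0 t \<in> X" "nag_y (grad f) \<eta> x0 t \<in> X"
      "f (nag_x (grad f) \<eta> x0 t) - f xstar \<le> 4 * D / (\<eta> * (real t)\<^sup>2 + 4)"
      using conv by blast+
  qed
qed

end
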